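(* Let $L_0$ be a normal modal logic. For any logic $L\in\mathsf{NExt}\,L_0$, the fmp span $\mathrm{fmp}_{L_0}(L)$, viewed as a subset of the Cantor space $2^\omega$ via the coding, is $\Pi^0_2(L_0\oplus L)$.
   Context: Modal formulas are generated from a countable set $\mathsf{Prop}$ of propositional variables by $\phi::=p\mid\bot\mid\phi\land\psi\mid\phi\to\psi\mid\Box\phi$. A normal modal logic is a set of formulas containing all propositional tautologies and $\Box(p\to q)\to\Box p\to\Box q$, and closed under modus ponens, necessitation and uniform substitution. $\mathsf{NExt}\,L_0$ is the set of normal modal logics $L$ with $L_0\subseteq L$. A Kripke frame $\mathcal{F}=(F,R)$ is a nonempty set $F$ with a binary relation $R\subseteq F\times F$. A valuation $V:\mathsf{Prop}\to\mathcal{P}(F)$ extends to all formulas, with Boolean connectives interpreted by Boolean operations and $V(\Box\phi)=\{x\in F:\forall y\,(Rxy\to y\in V(\phi))\}$. $\mathcal{F}\models\phi$ means $V(\phi)=F$ for all valuations $V$, and $\mathcal{F}\models L$ means $\mathcal{F}\models\phi$ for all $\phi\in L$. Let $\mathsf{FFr}$ be the class of all finite Kripke frames and $\mathsf{FFr}(L)=\{\mathcal{F}\in\mathsf{FFr}:\mathcal{F}\models L\}$. The fmp span of $L$ in $\mathsf{NExt}\,L_0$ is $$\mathrm{fmp}_{L_0}(L)=\{L'\in\mathsf{NExt}\,L_0:\mathsf{FFr}(L')=\mathsf{FFr}(L)\}.$$ Coding: modal formulas are coded injectively and effectively by natural numbers through a fixed standard Gödel numbering, and a logic is identified with the set of codes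 of its formulas, i.e. with an element of $2^\omega$ (reals are identified with subsets of $\omega$). For $A,B\subseteq\omega$, $A\oplus B=\{2n:n\in A\}\cup\{2n+1:n\in B\}$. For $a\in2^\omega$, a set $X\subseteq2^\omega$ is $\Pi^0_2(a)$ if there is a predicate $R$, recursive with the parameter $a$, such that for all $b\in2^\omega$: $b\in X$ iff $\forall m_1\in\omega\,\exists m_2\in\omega\;R(m_1,m_2,b,a)$. *)

theory Defs
  imports "HOL-Library.Nat_Bijection"
begin

datatype fm = Var nat | Bot | And fm fm | Imp fm fm | Box fm

fun fm_subst :: "(nat \<Rightarrow> fm) \<Rightarrow> fm \<Rightarrow> fm" where
  "fm_subst s (Var p) = s p"
| "fm_subst s Bot = Bot"
| "fm_subst s (And \<phi> \<psi>) = And (fm_subst s \<phi>) (fm_subst s \<psi>)"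
| "fm_subst s (Imp \<phi> \<psi>) = Imp (fm_subst s \<phi>) (fm_subst s \<psi>)"
| "fm_subst s (Box \<phi>) = Box (fm_subst s \<phi>)"

fun box_free :: "fm \<Rightarrow> bool" where
  "box_free (Var p) \<longleftrightarrow> True"
| "box_free Bot \<longleftrightarrow> True"
| "box_free (And \<phi> \<psi>) \<longleftrightarrow> box_free \<phi> \<and> box_free \<psi>"
| "box_free (Imp \<phi> \<psi>) \<longleftrightarrow> box_free \<phi> \<and> box_free \<psi>"
| "box_free (Box \<phi>) \<longleftrightarrow> False"

text \<open>The value on boxed formulas is irrelevant: this is only used for box-free formulas.\<close>

fun truth_value :: "(nat \<Rightarrow> bool) \<Rightarrow> fm \<Rightarrow> bool" where
  "truth_value v (Var p) \<longleftrightarrow> v p"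
| "truth_value v Bot \<longleftrightarrow> False"
| "truth_value v (And \<phi> \<psi>) \<longleftrightarrow> truth_value v \<phi> \<and> truth_value v \<psi>"
| "truth_value v (Imp \<phi> \<psi>) \<longleftrightarrow> (truth_value v \<phi> \<longrightarrow> truth_value v \<psi>)"
| "truth_value v (Box \<phi>) \<longleftrightarrow> undefined"

text \<open>Tautologies are taken in the box-free language; their modal instances belong to every
  normal modal logic by closure under uniform substitution.\<close>

definition tautology :: "fm \<Rightarrow> bool" where
  "tautology \<phi> \<longleftrightarrow> box_free \<phi> \<and> (\<forall>v. truth_value v \<phi>)"

definition axiom_K :: fm where
  "axiom_K = Imp (Box (Imp (Var 0) (Var 1))) (Imp (Box (Var 0)) (Box (Var 1)))"

definition normal_logic :: "fm set \<Rightarrow> bool" where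
  "normal_logic L \<longleftrightarrow>
     {\<phi>. tautology \<phi>} \<subseteq> L \<and>
     axiom_K \<in> L \<and>
     (\<forall>\<phi> \<psi>. \<phi> \<in> L \<and> Imp \<phi> \<psi> \<in> L \<longrightarrow> \<psi> \<in> L) \<and>
     (\<forall>\<phi>. \<phi> \<in> L \<longrightarrow> Box \<phi> \<in> L) \<and>
     (\<forall>\<phi> s. \<phi> \<in> L \<longrightarrow> fm_subst s \<phi> \<in> L)"

definition NExt :: "fm set \<Rightarrow> fm set set" where
  "NExt L0 = {L. normal_logic L \<and> L0 \<subseteq> L}"

type_synonym 'w frame = "'w set \<times> ('w \<times> 'w) set"

definition kripke_frame :: "'w frame \<Rightarrow> bool" where
  "kripke_frame F \<longleftrightarrow> fst F \<noteq> {} \<and> snd F \<subseteq> fst F \<times> fst F"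

fun truth_set :: "'w frame \<Rightarrow> (nat \<Rightarrow> 'w set) \<Rightarrow> fm \<Rightarrow> 'w set" where
  "truth_set F V (Var p) = V p"
| "truth_set F V Bot = {}"
| "truth_set F V (And \<phi> \<psi>) = truth_set F V \<phi> \<inter> truth_set F V \<psi>"
| "truth_set F V (Imp \<phi> \<psi>) = (fst F - truth_set F V \<phi>) \<union> truth_set F V \<psi>"
| "truth_set F V (Box \<phi>) = {x \<in> fst F. \<forall>y. (x, y) \<in> snd F \<longrightarrow> y \<in> truth_set F V \<phi>}"

definition valid :: "'w frame \<Rightarrow> fm \<Rightarrow> bool" where
  "valid F \<phi> \<longleftrightarrow> (\<forall>V. (\<forall>p. V p \<subseteq> fst F) \<longrightarrow> truth_set F V \<phi> = fst F)"

text \<open>The class of all finite frames is represented by the set of finite frames whose points are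
  natural numbers. Lemma \<open>finite_frame_over_nat\<close> below shows that nothing is lost: a finite
  frame over any type validates the same formulas as some member of \<open>FFr\<close>.\<close>

definition FFr :: "nat frame set" where
  "FFr = {F. kripke_frame F \<and> finite (fst F)}"

definition FFr_of :: "fm set \<Rightarrow> nat frame set" where
  "FFr_of L = {F \<in> FFr. \<forall>\<phi>\<in>L. valid F \<phi>}"

definition fmp_span :: "fm set \<Rightarrow> fm set \<Rightarrow> fm set set" where
  "fmp_span L0 L = {L' \<in> NExt L0. FFr_of L' = FFr_of L}"

lemma truth_set_subset:
  assumes "\<And>p. V p \<subseteq> fst F"
  shows "truth_set F V \<phi> \<subseteq> fst F"
  using assms by (induction \<phi>) auto

lemma truth_set_iso:
  assumes "inj_on h W" and R: "R \<subseteq> W \<times> W" and V: "\<And>p. V p \<subseteq> W"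
  shows "truth_set (h ` W, map_prod h h ` R) (\<lambda>p. h ` V p) \<phi> = h ` truth_set (W, R) V \<phi>"
proof (induction \<phi>)
  case (And \<phi> \<psi>)
  have "truth_set (W, R) V \<chi> \<subseteq> W" for \<chi>
    using truth_set_subset[of V "(W, R)"] V by simp
  then show ?case using And inj_on_image_Int[OF assms(1)] by simp
next
  case (Imp \<phi> \<psi>)
  have "truth_set (W, R) V \<chi> \<subseteq> W" for \<chi>
    using truth_set_subset[of V "(W, R)"] V by simp
  then show ?case
    using Imp inj_on_image_set_diff[OF assms(1), of W "truth_set (W, R) V \<phi>"]
    by (simp add: image_Un)
next
  case (Box \<phi>)
  have sub: "truth_set (W, R) V \<phi> \<subseteq> W"
    using truth_set_subset[of V "(W, R)"] V by simp
  have mem: "h y \<in> h ` truth_set (W, R) V \<phi> \<longleftrightarrow> y \<in> truth_set (W, R) V \<phi>" if "y \<in> W" for y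
    using inj_on_image_mem_iff[OF assms(1) that sub] .
  have edge: "(h x, z) \<in> map_prod h h ` R \<longleftrightarrow> (\<exists>y. z = h y \<and> (x, y) \<in> R)" if "x \<in> W" for x z
  proof
    assume "(h x, z) \<in> map_prod h h ` R"
    then obtain u y where uy: "(u, y) \<in> R" "h x = h u" "z = h y" by auto
    then have "x = u" using R that inj_onD[OF assms(1), of x u] by blast
    then show "\<exists>y. z = h y \<and> (x, y) \<in> R" using uy by blast
  next
    assume "\<exists>y. z = h y \<and> (x, y) \<in> R"
    then obtain y where "z = h y" "(x, y) \<in> R" by blast
    then show "(h x, z) \<in> map_prod h h ` R" by (metis map_prod_imageI)
  qed
  have box: "(\<forall>z. (h x, z) \<in> map_prod h h ` R \<longrightarrow> z \<in> h ` truth_set (W, R) V \<phi>) \<longleftrightarrow>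
        (\<forall>y. (x, y) \<in> R \<longrightarrow> y \<in> truth_set (W, R) V \<phi>)" if x: "x \<in> W" for x
  proof -
    have "(\<forall>z. (h x, z) \<in> map_prod h h ` R \<longrightarrow> z \<in> h ` truth_set (W, R) V \<phi>) \<longleftrightarrow>
        (\<forall>y. (x, y) \<in> R \<longrightarrow> h y \<in> h ` truth_set (W, R) V \<phi>)"
      unfolding edge[OF x] by metis
    also have "\<dots> \<longleftrightarrow> (\<forall>y. (x, y) \<in> R \<longrightarrow> y \<in> truth_set (W, R) V \<phi>)"
    proof (intro all_cong1 imp_cong refl)
      fix y assume "(x, y) \<in> R"
      then have "y \<in> W" using R by blast
      then show "h y \<in> h ` truth_set (W, R) V \<phi> \<longleftrightarrow> y \<in> truth_set (W, R) V \<phi>" by (rule mem)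
    qed
    finally show ?thesis .
  qed
  have "{w \<in> h ` W. \<forall>z. (w, z) \<in> map_prod h h ` R \<longrightarrow> z \<in> h ` truth_set (W, R) V \<phi>} =
        h ` {x \<in> W. \<forall>y. (x, y) \<in> R \<longrightarrow> y \<in> truth_set (W, R) V \<phi>}" (is "?A = ?B")
  proof (rule set_eqI)
    fix w
    have "w \<in> ?A \<longleftrightarrow> (\<exists>x. x \<in> W \<and> w = h x \<and>
        (\<forall>z. (h x, z) \<in> map_prod h h ` R \<longrightarrow> z \<in> h ` truth_set (W, R) V \<phi>))"
      unfolding mem_Collect_eq image_iff[of w h W] by metis
    also have "\<dots> \<longleftrightarrow> w \<in> ?B"
      unfolding image_iff[of w h] Bex_def mem_Collect_eq using box by metis
    finally show "w \<in> ?A \<longleftrightarrow> w \<in> ?B" .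
  qed
  then show ?case by (simp only: truth_set.simps fst_conv snd_conv Box)
qed simp_all

lemma finite_frame_over_nat:
  fixes F :: "'w frame"
  assumes "kripke_frame F" and "finite (fst F)"
  shows "\<exists>G\<in>FFr. \<forall>\<phi>. valid G \<phi> \<longleftrightarrow> valid F \<phi>"
proof -
  obtain W R where F: "F = (W, R)" by (cases F)
  have R: "R \<subseteq> W \<times> W" and ne: "W \<noteq> {}" and fin: "finite W"
    using assms by (auto simp: F kripke_frame_def)
  obtain h :: "'w \<Rightarrow> nat" where h: "inj_on h W"
    using finite_imp_inj_to_nat_seg[OF fin] by blast
  define G where "G = (h ` W, map_prod h h ` R)"
  have "G \<in> FFr"
    using R ne fin by (auto simp: G_def FFr_def kripke_frame_def)
  moreover have "valid G \<phi> \<longleftrightarrow> valid F \<phi>" for \<phi>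
  proof
    assume G: "valid G \<phi>"
    show "valid F \<phi>"
      unfolding valid_def
    proof (intro allI impI)
      fix V :: "nat \<Rightarrow> 'w set" assume "\<forall>p. V p \<subseteq> fst F"
      then have V: "\<And>p. V p \<subseteq> W" by (simp add: F)
      have "truth_set G (\<lambda>p. h ` V p) \<phi> = h ` W"
        using G V unfolding valid_def by (simp add: G_def image_mono)
      then have "h ` truth_set (W, R) V \<phi> = h ` W"
        using truth_set_iso[OF h R V] by (simp add: G_def)
      then show "truth_set F V \<phi> = fst F"
        using inj_on_image_eq_iff[OF h] truth_set_subset[of V "(W, R)" \<phi>] V by (simp add: F)
    qed
  next
    assume F': "valid F \<phi>"
    show "valid G \<phi>"
      unfolding valid_def
    proof (intro allI impI)
      fix V :: "nat \<Rightarrow> nat set" assume V: "\<forall>p. V p \<subseteq> fst G"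
      define U where "U = (\<lambda>p. W \<inter> h -` V p)"
      have U: "\<And>p. U p \<subseteq> W" by (simp add: U_def)
      have VU: "V = (\<lambda>p. h ` U p)"
        using V by (fastforce simp: U_def G_def)
      have "truth_set (W, R) U \<phi> = W"
        using F' U unfolding valid_def by (simp add: F)
      then show "truth_set G V \<phi> = fst G"
        using truth_set_iso[OF h R U] by (simp add: G_def VU)
    qed
  qed
  ultimately show ?thesis by blast
qed

fun code :: "fm \<Rightarrow> nat" where
  "code (Var p) = prod_encode (0, p)"
| "code Bot = prod_encode (1, 0)"
| "code (And \<phi> \<psi>) = prod_encode (2, prod_encode (code \<phi>, code \<psi>))"
| "code (Imp \<phi> \<psi>) = prod_encode (3, prod_encode (code \<phi>, code \<psi>))"
| "code (Box \<phi>) = prod_encode (4, code \<phi>)"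

lemma inj_code: "inj code"
proof (rule injI)
  show "code \<phi> = code \<psi> \<Longrightarrow> \<phi> = \<psi>" for \<phi> \<psi>
  proof (induction \<phi> arbitrary: \<psi>)
    case (Var p) then show ?case by (cases \<psi>) simp_all
  next
    case Bot then show ?case by (cases \<psi>) simp_all
  next
    case (And \<phi>1 \<phi>2) then show ?case by (cases \<psi>) simp_all
  next
    case (Imp \<phi>1 \<phi>2) then show ?case by (cases \<psi>) simp_all
  next
    case (Box \<phi>) then show ?case by (cases \<psi>) simp_all
  qed
qed

definition codes :: "fm set \<Rightarrow> nat set" where
  "codes L = code ` L"

definition oplus :: "nat set \<Rightarrow> nat set \<Rightarrow> nat set" where
  "oplus A B = {2 * n | n. n \<in> A} \<union> {2 * n + 1 | n. n \<in> B}"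

text \<open>\<open>recursive_functional a n f\<close>: the total functional \<open>f b [x\<^sub>1, \<dots>, x\<^sub>n]\<close> of a set \<open>b\<close> and
  \<open>n\<close> numbers is recursive with the set \<open>a\<close> as a parameter. As usual for total functionals,
  these are generated from the initial functions and the characteristic functions of \<open>a\<close> and of
  the argument \<open>b\<close> by composition, primitive recursion and minimization, where
  minimization is applied only if it yields a total functional. The derivation does not depend on
  \<open>b\<close>, so the computation is uniform in \<open>b\<close>. Rule \<open>ext\<close> reflects that only the
  values on lists of length \<open>n\<close> matter.\<close>

inductive recursive_functional :: "nat set \<Rightarrow> nat \<Rightarrow> (nat set \<Rightarrow> nat list \<Rightarrow> nat) \<Rightarrow> bool"
  for a :: "nat set" where
  zero: "recursive_functional a n (\<lambda>b xs. 0)"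
| succ: "recursive_functional a 1 (\<lambda>b xs. Suc (xs ! 0))"
| proj: "i < n \<Longrightarrow> recursive_functional a n (\<lambda>b xs. xs ! i)"
| char_parameter: "recursive_functional a 1 (\<lambda>b xs. of_bool (xs ! 0 \<in> a))"
| char_argument: "recursive_functional a 1 (\<lambda>b xs. of_bool (xs ! 0 \<in> b))"
| comp: "recursive_functional a (length gs) f \<Longrightarrow>
    (\<forall>g\<in>set gs. recursive_functional a n g) \<Longrightarrow>
    recursive_functional a n (\<lambda>b xs. f b (map (\<lambda>g. g b xs) gs))"
| prim_rec: "recursive_functional a n f \<Longrightarrow>
    recursive_functional a (Suc (Suc n)) g \<Longrightarrow>
    recursive_functional a (Suc n)
      (\<lambda>b xs. rec_nat (f b (tl xs)) (\<lambda>k r. g b (k # r # tl xs)) (hd xs))"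
| mu: "recursive_functional a (Suc n) f \<Longrightarrow>
    (\<forall>b xs. length xs = n \<longrightarrow> (\<exists>y. f b (y # xs) = 0)) \<Longrightarrow>
    recursive_functional a n (\<lambda>b xs. LEAST y. f b (y # xs) = 0)"
| ext: "recursive_functional a n f \<Longrightarrow>
    (\<forall>b xs. length xs = n \<longrightarrow> g b xs = f b xs) \<Longrightarrow>
    recursive_functional a n g"

definition recursive_predicate :: "nat set \<Rightarrow> (nat \<Rightarrow> nat \<Rightarrow> nat set \<Rightarrow> bool) \<Rightarrow> bool" where
  "recursive_predicate a R \<longleftrightarrow>
     (\<exists>f. recursive_functional a 2 f \<and> (\<forall>m1 m2 b. f b [m1, m2] = of_bool (R m1 m2 b)))"

definition Pi02 :: "nat set \<Rightarrow> nat set set \<Rightarrow> bool" where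
  "Pi02 a X \<longleftrightarrow>
     (\<exists>R. recursive_predicate a R \<and> (\<forall>b. b \<in> X \<longleftrightarrow> (\<forall>m1. \<exists>m2. R m1 m2 b)))"

end

theory Submission imports Defs begin

text \<open>A set \<open>b\<close> of numbers is the code set of a member of the span iff it consists of codes of
  formulas and, for \<open>L'\<close> the set of formulas coded in \<open>b\<close>, a handful of closure conditions hold:
  \<open>L'\<close> contains \<open>L0\<close>, the tautologies and the axiom K, is closed under the three rules, and has the
  same finite frames as \<open>L\<close> (\<open>codes_fmp_span\<close>). Each condition separately is \<open>\<Pi>\<^sup>0\<^sub>2\<close>, and
  \<open>\<Pi>\<^sup>0\<^sub>2\<close> classes are closed under intersection because two witnesses can be paired into one
  (\<open>Pi02_Int\<close>).

  The essential condition is the one on frames. The inclusion of the finite frames of \<open>L\<close> in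
  those of \<open>L'\<close> says: for every finite frame, every valuation on it and every formula
  of \<open>L'\<close> which this valuation refutes, there are a formula of \<open>L\<close> and a valuation on the same frame
  that refutes it (\<open>FFr_of_subset_iff\<close>). A finite frame, and the part of a valuation that concerns
  the variables of one formula, are finite objects, so both quantifier blocks range over numbers;
  membership in \<open>L\<close> and \<open>L'\<close> is read off from the parameter and from \<open>b\<close>. Hence
  this is a \<open>\<forall>\<exists>\<close> statement about a recursive relation as soon as it is decidable whether a given
  finite model refutes a given formula (\<open>decidable_refutes\<close>). The converse inclusion is symmetric.
  Likewise a tautology is a formula that no finite partial valuation falsifies, and only finitely
  many values of a substitution matter for one formula.

  What remains is to show that operations defined by structural recursion on formulas are
  recursive on codes. This is course-of-values recursion, since codes of subformulas are smaller
  (\<open>computable_fm_rec\<close>); it is obtained from primitive recursion by computing the list of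
  all previous values, stored as iterated pairs.\<close>

section \<open>Recursive functionals of a list of arguments\<close>

lemma rf_comp1:
  assumes "recursive_functional a 1 f" "recursive_functional a n g"
  shows "recursive_functional a n (\<lambda>b xs. f b [g b xs])"
  using comp[of a "[g]" f n] assms by simp

lemma rf_comp2:
  assumes "recursive_functional a 2 f" "recursive_functional a n g" "recursive_functional a n h"
  shows "recursive_functional a n (\<lambda>b xs. f b [g b xs, h b xs])"
  using comp[of a "[g, h]" f n] assms by (simp add: numeral_2_eq_2)

lemma rf_Suc:
  assumes "recursive_functional a n f"
  shows "recursive_functional a n (\<lambda>b xs. Suc (f b xs))"
  using rf_comp1[OF succ assms] by simp

lemma rf_add:
  assumes "recursive_functional a n f" "recursive_functional a n g"
  shows "recursive_functional a n (\<lambda>b xs. f b xs + g b xs)"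
proof -
  have "recursive_functional a (Suc 1)
      (\<lambda>b xs. rec_nat (tl xs ! 0) (\<lambda>k r. Suc ((k # r # tl xs) ! 1)) (hd xs))"
    by (rule prim_rec) (auto intro!: proj rf_Suc)
  moreover have "rec_nat y (\<lambda>k r. Suc r) x = x + y" for x y :: nat
    by (induction x) auto
  ultimately have "recursive_functional a 2 (\<lambda>b xs. hd xs + tl xs ! 0)"
    by (simp add: numeral_2_eq_2)
  from rf_comp2[OF this assms] show ?thesis by simp
qed

lemma rf_pred:
  assumes "recursive_functional a n f"
  shows "recursive_functional a n (\<lambda>b xs. f b xs - 1)"
proof -
  have "recursive_functional a (Suc 0)
      (\<lambda>b xs. rec_nat 0 (\<lambda>k r. (k # r # tl xs) ! 0) (hd xs))"
    by (rule prim_rec) (auto intro!: proj zero)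
  moreover have "rec_nat 0 (\<lambda>k r. k) x = x - 1" for x :: nat
    by (induction x) auto
  ultimately have "recursive_functional a 1 (\<lambda>b xs. hd xs - 1)"
    by simp
  from rf_comp1[OF this assms] show ?thesis by simp
qed

lemma rf_diff:
  assumes "recursive_functional a n f" "recursive_functional a n g"
  shows "recursive_functional a n (\<lambda>b xs. f b xs - g b xs)"
proof -
  have "recursive_functional a (Suc 1)
      (\<lambda>b xs. rec_nat (tl xs ! 0) (\<lambda>k r. (k # r # tl xs) ! 1 - 1) (hd xs))"
    by (rule prim_rec) (intro proj rf_pred; simp)+
  moreover have "rec_nat y (\<lambda>k r. r - 1) x = y - x" for x y :: nat
    by (induction x) auto
  ultimately have "recursive_functional a 2 (\<lambda>b xs. tl xs ! 0 - hd xs)"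
    by (simp add: numeral_2_eq_2)
  from rf_comp2[OF this assms(2,1)] show ?thesis by simp
qed

lemma rf_triangle:
  assumes "recursive_functional a n f"
  shows "recursive_functional a n (\<lambda>b xs. triangle (f b xs))"
proof -
  have "recursive_functional a (Suc 0)
      (\<lambda>b xs. rec_nat 0 (\<lambda>k r. (k # r # tl xs) ! 1 + Suc ((k # r # tl xs) ! 0)) (hd xs))"
    by (rule prim_rec) (auto intro!: proj zero rf_Suc rf_add)
  moreover have "rec_nat 0 (\<lambda>k r. r + Suc k) x = triangle x" for x :: nat
    by (induction x) (auto simp: triangle_Suc)
  ultimately have "recursive_functional a 1 (\<lambda>b xs. triangle (hd xs))"
    by simp
  from rf_comp1[OF this assms] show ?thesis by simp
qed

lemma rf_prod_encode:
  assumes "recursive_functional a n f" "recursive_functional a n g"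
  shows "recursive_functional a n (\<lambda>b xs. prod_encode (f b xs, g b xs))"
  unfolding prod_encode_def by (auto intro!: rf_add rf_triangle assms)

definition pfst :: "nat \<Rightarrow> nat" where
  "pfst n = fst (prod_decode n)"

definition psnd :: "nat \<Rightarrow> nat" where
  "psnd n = snd (prod_decode n)"

lemma pfst_prod_encode [simp]: "pfst (prod_encode (x, y)) = x"
  by (simp add: pfst_def)

lemma psnd_prod_encode [simp]: "psnd (prod_encode (x, y)) = y"
  by (simp add: psnd_def)

lemma prod_encode_pfst_psnd [simp]: "prod_encode (pfst n, psnd n) = n"
  by (simp add: pfst_def psnd_def)

lemma triangle_mono: "m \<le> n \<Longrightarrow> triangle m \<le> triangle n"
  by (induction n rule: dec_induct) auto

text \<open>The Cantor pairing function enumerates the diagonals one after the other, the diagonal of sum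
  \<open>s\<close> starting at the number \<open>triangle s\<close>. So the diagonal of \<open>n\<close> is found by
  minimization, and both projections are differences computed from it.\<close>

lemma diagonal_eq_Least: "pfst n + psnd n = (LEAST s. Suc n - triangle (Suc s) = 0)"
proof (rule Least_equality[symmetric])
  let ?s = "pfst n + psnd n"
  have n: "n = triangle ?s + pfst n"
    using prod_encode_pfst_psnd[of n] by (simp add: prod_encode_def)
  show "Suc n - triangle (Suc ?s) = 0"
    using n by simp
  fix s assume "Suc n - triangle (Suc s) = 0"
  then have "triangle ?s < triangle (Suc s)" using n by simp
  then show "?s \<le> s"
    using triangle_mono[of "Suc s" ?s] by (meson not_less not_less_eq_eq)
qed

lemma rf_diagonal:
  assumes "recursive_functional a n f"
  shows "recursive_functional a n (\<lambda>b xs. pfst (f b xs) + psnd (f b xs))"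
proof -
  have "\<exists>y. Suc m - triangle (Suc y) = 0" for m
    by (rule exI[of _ m]) simp
  then have "recursive_functional a 1
      (\<lambda>b xs. LEAST y. Suc ((y # xs) ! 1) - triangle (Suc ((y # xs) ! 0)) = 0)"
    by (intro mu rf_diff rf_Suc rf_triangle proj) simp_all
  then have "recursive_functional a 1 (\<lambda>b xs. pfst (xs ! 0) + psnd (xs ! 0))"
    by (simp add: diagonal_eq_Least)
  from rf_comp1[OF this assms] show ?thesis by simp
qed

lemma rf_pfst:
  assumes "recursive_functional a n f"
  shows "recursive_functional a n (\<lambda>b xs. pfst (f b xs))"
proof -
  have "pfst m = m - triangle (pfst m + psnd m)" for m
    using prod_encode_pfst_psnd[of m] unfolding prod_encode_def by simp
  moreover have "recursive_functional a n
      (\<lambda>b xs. f b xs - triangle (pfst (f b xs) + psnd (f b xs)))"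
    by (intro rf_diff rf_triangle rf_diagonal assms)
  ultimately show ?thesis by simp
qed

lemma rf_psnd:
  assumes "recursive_functional a n f"
  shows "recursive_functional a n (\<lambda>b xs. psnd (f b xs))"
proof -
  have "recursive_functional a n (\<lambda>b xs. (pfst (f b xs) + psnd (f b xs)) - pfst (f b xs))"
    by (intro rf_diff rf_pfst rf_diagonal assms)
  then show ?thesis by simp
qed

section \<open>Recursive functionals of a single coded context\<close>

text \<open>All numerical arguments are packed into one number, the context. A binder pushes its
  variable onto the context by pairing, so variables are iterated projections, and the closure rules
  below are higher-order patterns that reduce recursiveness proofs to resolution.\<close>

definition computable :: "nat set \<Rightarrow> (nat set \<Rightarrow> nat \<Rightarrow> nat) \<Rightarrow> bool" where
  "computable a f \<longleftrightarrow> recursive_functional a 1 (\<lambda>b xs. f b (xs ! 0))"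

abbreviation decidable :: "nat set \<Rightarrow> (nat set \<Rightarrow> nat \<Rightarrow> bool) \<Rightarrow> bool" where
  "decidable a P \<equiv> computable a (\<lambda>b c. of_bool (P b c))"

lemma computable_rf:
  assumes "computable a f" "recursive_functional a n g"
  shows "recursive_functional a n (\<lambda>b xs. f b (g b xs))"
  using rf_comp1[OF assms(1)[unfolded computable_def] assms(2)] by simp

lemma computable_comp:
  assumes "computable a f" "computable a g"
  shows "computable a (\<lambda>b c. f b (g b c))"
  using computable_rf[OF assms(1) assms(2)[unfolded computable_def]] by (simp add: computable_def)

named_theorems computable_intros

lemma computable_id [computable_intros]: "computable a (\<lambda>b c. c)"
  unfolding computable_def by (rule proj) simp

lemma computable_Suc [computable_intros]:
  "computable a f \<Longrightarrow> computable a (\<lambda>b c. Suc (f b c))"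
  unfolding computable_def by (rule rf_Suc)

lemma computable_const [computable_intros]: "computable a (\<lambda>b c. k)"
proof (induction k)
  case 0
  show ?case unfolding computable_def by (rule zero)
next
  case (Suc k)
  then show ?case by (rule computable_Suc)
qed

lemma computable_add [computable_intros]:
  "computable a f \<Longrightarrow> computable a g \<Longrightarrow> computable a (\<lambda>b c. f b c + g b c)"
  unfolding computable_def by (rule rf_add)

lemma computable_diff [computable_intros]:
  "computable a f \<Longrightarrow> computable a g \<Longrightarrow> computable a (\<lambda>b c. f b c - g b c)"
  unfolding computable_def by (rule rf_diff)

lemma computable_prod_encode [computable_intros]:
  "computable a f \<Longrightarrow> computable a g \<Longrightarrow> computable a (\<lambda>b c. prod_encode (f b c, g b c))"
  unfolding computable_def by (rule rf_prod_encode)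

lemma computable_pfst [computable_intros]:
  "computable a f \<Longrightarrow> computable a (\<lambda>b c. pfst (f b c))"
  unfolding computable_def by (rule rf_pfst)

lemma computable_psnd [computable_intros]:
  "computable a f \<Longrightarrow> computable a (\<lambda>b c. psnd (f b c))"
  unfolding computable_def by (rule rf_psnd)

lemma decidable_parameter [computable_intros]:
  "computable a f \<Longrightarrow> decidable a (\<lambda>b c. f b c \<in> a)"
  using computable_comp[of a "\<lambda>b c. of_bool (c \<in> a)" f] char_parameter
  by (simp add: computable_def)

lemma decidable_argument [computable_intros]:
  "computable a f \<Longrightarrow> decidable a (\<lambda>b c. f b c \<in> b)"
  using computable_comp[of a "\<lambda>b c. of_bool (c \<in> b)" f] char_argument
  by (simp add: computable_def)

lemma computable_comp2:
  assumes "computable a (\<lambda>b c. h b (pfst c) (psnd c))" "computable a f" "computable a g"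
  shows "computable a (\<lambda>b c. h b (f b c) (g b c))"
  using computable_comp[OF assms(1) computable_prod_encode[OF assms(2,3)]] by simp

lemma computable_comp3:
  assumes "computable a (\<lambda>b c. h b (pfst c) (pfst (psnd c)) (psnd (psnd c)))"
    and "computable a f" "computable a g" "computable a k"
  shows "computable a (\<lambda>b c. h b (f b c) (g b c) (k b c))"
  using computable_comp[OF assms(1)
      computable_prod_encode[OF assms(2) computable_prod_encode[OF assms(3,4)]]] by simp

lemma computable_rec_nat [computable_intros]:
  assumes f: "computable a f"
    and g: "computable a (\<lambda>b c. g b (pfst c) (pfst (psnd c)) (psnd (psnd c)))"
    and h: "computable a h"
  shows "computable a (\<lambda>b c. rec_nat (f b c) (\<lambda>k r. g b k r c) (h b c))"
proof -
  have "recursive_functional a (Suc (Suc 1))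
      (\<lambda>b xs. g b (xs ! 0) (xs ! 1) (xs ! 2))"
  proof -
    have "recursive_functional a (Suc (Suc 1))
        (\<lambda>b xs. prod_encode (xs ! 0, prod_encode (xs ! 1, xs ! 2)))"
      by (intro rf_prod_encode proj) simp_all
    from computable_rf[OF g this] show ?thesis by simp
  qed
  from prim_rec[OF f[unfolded computable_def] this]
  have "recursive_functional a 2
      (\<lambda>b xs. rec_nat (f b (tl xs ! 0)) (\<lambda>k r. g b k r (tl xs ! 0)) (hd xs))"
    by (simp add: numeral_2_eq_2)
  from rf_comp2[OF this h[unfolded computable_def] computable_id[unfolded computable_def]]
  show ?thesis by (simp add: computable_def)
qed

lemma computable_Least:
  assumes f: "computable a (\<lambda>b c. f b (pfst c) (psnd c))"
    and ex: "\<And>b c. \<exists>y. f b y c = 0"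
  shows "computable a (\<lambda>b c. LEAST y. f b y c = 0)"
proof -
  have "recursive_functional a (Suc 1) (\<lambda>b xs. f b (xs ! 0) (xs ! 1))"
  proof -
    have "recursive_functional a (Suc 1) (\<lambda>b xs. prod_encode (xs ! 0, xs ! 1))"
      by (intro rf_prod_encode proj) simp_all
    from computable_rf[OF f this] show ?thesis by simp
  qed
  from mu[OF this] ex show ?thesis by (simp add: computable_def)
qed

lemma computable_mult [computable_intros]:
  assumes "computable a f" "computable a g"
  shows "computable a (\<lambda>b c. f b c * g b c)"
proof -
  have "rec_nat 0 (\<lambda>k r. r + x) y = y * x" for x y :: nat
    by (induction y) auto
  moreover have "computable a (\<lambda>b c. rec_nat 0 (\<lambda>k r. r + g b c) (f b c))"
    by (intro computable_intros assms computable_comp[OF assms(2)])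
  ultimately show ?thesis by simp
qed

lemma computable_power2 [computable_intros]:
  assumes "computable a f"
  shows "computable a (\<lambda>b c. 2 ^ f b c)"
proof -
  have "rec_nat 1 (\<lambda>k r. r + r) y = (2 :: nat) ^ y" for y :: nat
    by (induction y) auto
  moreover have "computable a (\<lambda>b c. rec_nat 1 (\<lambda>k r. r + r) (f b c))"
    by (intro computable_intros assms)
  ultimately show ?thesis by simp
qed

lemma decidable_not [computable_intros]:
  assumes "decidable a P"
  shows "decidable a (\<lambda>b c. \<not> P b c)"
proof -
  have "computable a (\<lambda>b c. 1 - of_bool (P b c))"
    by (intro computable_intros assms)
  moreover have "1 - of_bool p = (of_bool (\<not> p) :: nat)" for p by simp
  ultimately show ?thesis by (simp only:)
qed

lemma decidable_conj [computable_intros]: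
  assumes "decidable a P" "decidable a Q"
  shows "decidable a (\<lambda>b c. P b c \<and> Q b c)"
  using computable_mult[OF assms] by (simp add: of_bool_conj)

lemma decidable_imp [computable_intros]:
  assumes "decidable a P" "decidable a Q"
  shows "decidable a (\<lambda>b c. P b c \<longrightarrow> Q b c)"
proof -
  have "decidable a (\<lambda>b c. \<not> (P b c \<and> \<not> Q b c))"
    by (intro computable_intros assms)
  then show ?thesis by simp
qed

lemma decidable_eq [computable_intros]:
  assumes "computable a f" "computable a g"
  shows "decidable a (\<lambda>b c. f b c = g b c)"
proof -
  have "computable a (\<lambda>b c. 1 - ((f b c - g b c) + (g b c - f b c)))"
    by (intro computable_intros assms)
  moreover have "1 - ((x - y) + (y - x)) = of_bool (x = y)" for x y :: nat
    by auto
  ultimately show ?thesis by simp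
qed

lemma computable_if [computable_intros]:
  assumes "decidable a P" "computable a f" "computable a g"
  shows "computable a (\<lambda>b c. if P b c then f b c else g b c)"
proof -
  have "computable a (\<lambda>b c. of_bool (P b c) * f b c + of_bool (\<not> P b c) * g b c)"
    by (intro computable_intros assms)
  moreover have "of_bool p * x + of_bool (\<not> p) * y = (if p then x else y)" for p and x y :: nat
    by simp
  ultimately show ?thesis by simp
qed

lemma decidable_bounded_all [computable_intros]:
  assumes "computable a g" "decidable a (\<lambda>b c. P b (pfst c) (psnd c))"
  shows "decidable a (\<lambda>b c. \<forall>k < g b c. P b k c)"
proof -
  have "computable a (\<lambda>b c. rec_nat 1 (\<lambda>k r. if P b k c then r else 0) (g b c))"
    by (intro computable_intros assms computable_comp2[OF assms(2)])
  moreover have "rec_nat 1 (\<lambda>k r. if Q k then r else 0) n = (of_bool (\<forall>k<n. Q k) :: nat)" for Q n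
    by (induction n) (auto simp: less_Suc_eq)
  ultimately show ?thesis by (simp only:)
qed

section \<open>Finite sets coded by binary expansions\<close>

lemma computable_half [computable_intros]:
  assumes "computable a f"
  shows "computable a (\<lambda>b c. f b c div 2)"
proof -
  have ex: "\<exists>y. Suc x - (2 * y + 2) = 0" for x :: nat
    by (rule exI[of _ x]) simp
  have "(LEAST y. Suc x - (2 * y + 2) = 0) = x div 2" for x :: nat
    by (rule Least_equality) linarith+
  moreover have "computable a (\<lambda>b c. LEAST y. Suc c - (2 * y + 2) = 0)"
    by (intro computable_Least computable_intros ex)
  ultimately have "computable a (\<lambda>b c. c div 2)" by simp
  from computable_comp[OF this assms] show ?thesis .
qed

lemma decidable_set_decode [computable_intros]:
  assumes "computable a f" "computable a g"
  shows "decidable a (\<lambda>b c. f b c \<in> set_decode (g b c))"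
proof -
  let ?shift = "\<lambda>x n. rec_nat n (\<lambda>k r. r div 2) x"
  have shift: "?shift x n = n div 2 ^ x" for x n :: nat
    by (induction x) (simp_all add: div_mult2_eq[symmetric] mult.commute)
  have "decidable a (\<lambda>b c. \<not> 2 * (?shift (f b c) (g b c) div 2) = ?shift (f b c) (g b c))"
    by (intro computable_intros assms)
  moreover have "(\<not> 2 * (m div 2) = m) = odd m" for m :: nat
    by presburger
  ultimately show ?thesis by (simp add: shift set_decode_def)
qed

lemma computable_set_encode [computable_intros]:
  assumes "computable a g" "decidable a (\<lambda>b c. P b (pfst c) (psnd c))"
  shows "computable a (\<lambda>b c. set_encode {i. i < g b c \<and> P b i c})"
proof -
  have "computable a (\<lambda>b c. rec_nat 0 (\<lambda>k r. if P b k c then 2 ^ k + r else r) (g b c))"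
    by (intro computable_intros assms computable_comp2[OF assms(2)])
  moreover have "rec_nat 0 (\<lambda>k r. if Q k then 2 ^ k + r else r) n = set_encode {i. i < n \<and> Q i}"
    for Q and n :: nat
  proof (induction n)
    case (Suc n)
    have "{i. i < Suc n \<and> Q i} = (if Q n then insert n else id) {i. i < n \<and> Q i}"
      by (auto simp: less_Suc_eq)
    then show ?case using Suc by simp
  qed simp
  ultimately show ?thesis by simp
qed

lemma set_decode_less: "x \<in> set_decode n \<Longrightarrow> x < n"
  by (metis finite_set_decode less_exp less_le_trans set_decode_inverse
      set_encode_def sum.remove le_add1)

section \<open>Course-of-values recursion along the subformulas of a coded formula\<close>

text \<open>A number is also a stack of numbers, with the top as first component.\<close>

definition entry :: "nat \<Rightarrow> nat \<Rightarrow> nat" where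
  "entry t i = pfst (rec_nat t (\<lambda>k r. psnd r) i)"

lemma entry_push [simp]:
  "entry (prod_encode (x, t)) 0 = x" "entry (prod_encode (x, t)) (Suc i) = entry t i"
proof -
  have "rec_nat (prod_encode (x, t)) (\<lambda>k r. psnd r) (Suc i) = rec_nat t (\<lambda>k r. psnd r) i"
    by (induction i) auto
  then show "entry (prod_encode (x, t)) (Suc i) = entry t i"
    unfolding entry_def by metis
qed (simp add: entry_def)

lemma ex_entry: "\<exists>t. \<forall>i<n. entry t i = f i"
proof (induction n arbitrary: f)
  case (Suc n)
  obtain t where t: "\<forall>i<n. entry t i = f (Suc i)" using Suc[of "\<lambda>i. f (Suc i)"] by blast
  have "\<forall>i<Suc n. entry (prod_encode (f 0, t)) i = f i"
    using t by (auto simp: less_Suc_eq_0_disj)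
  then show ?case by blast
qed simp

lemma computable_entry [computable_intros]:
  "computable a f \<Longrightarrow> computable a g \<Longrightarrow> computable a (\<lambda>b c. entry (f b c) (g b c))"
  unfolding entry_def by (intro computable_intros)

definition history :: "(nat \<Rightarrow> nat) \<Rightarrow> nat \<Rightarrow> nat" where
  "history f n = rec_nat 0 (\<lambda>k r. prod_encode (f k, r)) n"

lemma history_Suc: "history f (Suc n) = prod_encode (f n, history f n)"
  by (simp add: history_def)

lemma entry_history: "i < n \<Longrightarrow> entry (history f n) (n - Suc i) = f i"
proof (induction n)
  case (Suc n)
  then show ?case
    by (cases "i = n") (auto simp: history_def Suc_diff_Suc[symmetric] less_Suc_eq)
qed simp

text \<open>The history of \<open>F\<close> is itself defined by primitive recursion, since each new value
  is a function of the history so far.\<close>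

lemma computable_course_of_values:
  assumes G: "computable a (\<lambda>b c. G b (pfst c) (pfst (psnd c)) (psnd (psnd c)))"
    and F: "\<And>b n c. F b n c = G b n (history (\<lambda>i. F b i c) n) c"
    and g: "computable a g"
  shows "computable a (\<lambda>b c. F b (g b c) c)"
proof -
  let ?T = "\<lambda>b n c. rec_nat 0 (\<lambda>k r. prod_encode (G b k r c, r)) n"
  have T: "?T b n c = history (\<lambda>i. F b i c) n" for b n c
  proof (induction n)
    case (Suc n)
    have "?T b (Suc n) c = prod_encode (G b n (?T b n c) c, ?T b n c)"
      by simp
    also have "\<dots> = prod_encode (F b n c, history (\<lambda>i. F b i c) n)"
      by (simp only: Suc F[of b n c])
    finally show ?case by (simp only: history_Suc)
  qed (simp add: history_def)
  have "computable a (\<lambda>b c. G b (g b c) (?T b (g b c) c) c)"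
    by (intro computable_comp3[OF G] computable_intros g)
  then show ?thesis by (simp only: T F[symmetric])
qed

lemma prod_encode_greater: "0 < m \<Longrightarrow> k < prod_encode (m, k)"
proof -
  assume "0 < m"
  have "n \<le> triangle n" for n by (induction n) auto
  from this[of "m + k"] \<open>0 < m\<close> show ?thesis by (simp add: prod_encode_def)
qed

lemma psnd_less: "0 < pfst n \<Longrightarrow> psnd n < n"
  using prod_encode_greater[of "pfst n" "psnd n"] by simp

lemma pfst_le: "pfst n \<le> n"
  using le_prod_encode_1[of "pfst n" "psnd n"] by simp

lemma psnd_le: "psnd n \<le> n"
  using le_prod_encode_2[of "psnd n" "pfst n"] by simp

text \<open>A total left inverse of \<^const>\<open>code\<close>. Numbers with a malformed tag are read as
  \<^const>\<open>Bot\<close>, so that quantifiers over formulas become quantifiers over all numbers.\<close>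

function decode :: "nat \<Rightarrow> fm" where
  "decode n =
     (if pfst n = 0 then Var (psnd n)
      else if pfst n = 2 then And (decode (pfst (psnd n))) (decode (psnd (psnd n)))
      else if pfst n = 3 then Imp (decode (pfst (psnd n))) (decode (psnd (psnd n)))
      else if pfst n = 4 then Box (decode (psnd n))
      else Bot)"
  by auto
termination
  by (relation "measure id")
     (auto intro: psnd_less le_less_trans[OF pfst_le psnd_less] le_less_trans[OF psnd_le psnd_less])

declare decode.simps [simp del]

lemma decode_code [simp]: "decode (code \<phi>) = \<phi>"
  by (induction \<phi>) (subst decode.simps; simp)+

text \<open>Structural recursion on formulas is course-of-values recursion on codes, because the code of
  a formula exceeds the codes of its immediate subformulas.\<close>

lemma computable_fm_rec:
  fixes \<Phi> :: "nat set \<Rightarrow> nat \<Rightarrow> fm \<Rightarrow> nat"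
  assumes Var: "computable a (\<lambda>b c. v b (pfst c) (psnd c))"
      "\<And>b c p. \<Phi> b c (Var p) = v b p c"
    and Bot: "computable a bt" "\<And>b c. \<Phi> b c Bot = bt b c"
    and And: "computable a (\<lambda>b c. an b (pfst c) (pfst (psnd c)) (psnd (psnd c)))"
      "\<And>b c \<phi> \<psi>. \<Phi> b c (And \<phi> \<psi>) = an b (\<Phi> b c \<phi>) (\<Phi> b c \<psi>) c"
    and Imp: "computable a (\<lambda>b c. im b (pfst c) (pfst (psnd c)) (psnd (psnd c)))"
      "\<And>b c \<phi> \<psi>. \<Phi> b c (Imp \<phi> \<psi>) = im b (\<Phi> b c \<phi>) (\<Phi> b c \<psi>) c"
    and Box: "computable a (\<lambda>b c. bx b (pfst c) (psnd c))"
      "\<And>b c \<phi>. \<Phi> b c (Box \<phi>) = bx b (\<Phi> b c \<phi>) c"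
    and g: "computable a g"
  shows "computable a (\<lambda>b c. \<Phi> b c (decode (g b c)))"
proof -
  \<comment> \<open>The value at \<open>i\<close> is the entry of depth \<open>n - Suc i\<close> in the history up to \<open>n\<close>.\<close>
  define G where "G = (\<lambda>b n t c.
     if pfst n = 0 then v b (psnd n) c
     else if pfst n = 2 then
       an b (entry t (n - Suc (pfst (psnd n)))) (entry t (n - Suc (psnd (psnd n)))) c
     else if pfst n = 3 then
       im b (entry t (n - Suc (pfst (psnd n)))) (entry t (n - Suc (psnd (psnd n)))) c
     else if pfst n = 4 then bx b (entry t (n - Suc (psnd n))) c
     else bt b c)"
  have "computable a (\<lambda>b c. G b (pfst c) (pfst (psnd c)) (psnd (psnd c)))"
    unfolding G_def
    by (intro computable_if computable_comp2[OF Var(1)] computable_comp3[OF And(1)]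
        computable_comp3[OF Imp(1)] computable_comp2[OF Box(1)] computable_comp[OF Bot(1)]
        computable_intros)
  moreover have "\<Phi> b c (decode n) = G b n (history (\<lambda>i. \<Phi> b c (decode i)) n) c" for b n c
  proof -
    have "pfst (psnd n) < n" "psnd (psnd n) < n" "psnd n < n" if "0 < pfst n"
      using psnd_less[OF that] pfst_le[of "psnd n"] psnd_le[of "psnd n"] by auto
    then show ?thesis
      by (subst decode.simps) (auto simp: G_def entry_history Var(2) Bot(2) And(2) Imp(2) Box(2))
  qed
  ultimately show ?thesis
    using g by (rule computable_course_of_values[where G = G and F = "\<lambda>b n c. \<Phi> b c (decode n)"])
qed

section \<open>Decidability of the syntactic and semantic notions\<close>

text \<open>With this, being the code of a formula is decidable: the codes are the fixed points of
  re-encoding.\<close>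

lemma computable_code_decode [computable_intros]:
  assumes "computable a g"
  shows "computable a (\<lambda>b c. code (decode (g b c)))"
  by (rule computable_fm_rec[where \<Phi> = "\<lambda>b c. code"
      and v = "\<lambda>b p c. prod_encode (0, p)" and bt = "\<lambda>b c. prod_encode (1, 0)"
      and an = "\<lambda>b x y c. prod_encode (2, prod_encode (x, y))"
      and im = "\<lambda>b x y c. prod_encode (3, prod_encode (x, y))"
      and bx = "\<lambda>b x c. prod_encode (4, x)"])
     ((simp; fail) | intro computable_intros assms)+

lemma computable_code_Imp [computable_intros]:
  "computable a (\<lambda>b c. code (\<phi> b c)) \<Longrightarrow> computable a (\<lambda>b c. code (\<psi> b c)) \<Longrightarrow>
   computable a (\<lambda>b c. code (Imp (\<phi> b c) (\<psi> b c)))"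
  unfolding code.simps by (intro computable_intros)

lemma computable_code_Box [computable_intros]:
  "computable a (\<lambda>b c. code (\<phi> b c)) \<Longrightarrow> computable a (\<lambda>b c. code (Box (\<phi> b c)))"
  unfolding code.simps by (intro computable_intros)

text \<open>A substitution is coded by the stack of the codes of its first values.\<close>

definition subst_of :: "nat \<Rightarrow> nat \<Rightarrow> fm" where
  "subst_of s p = decode (entry s p)"

lemma computable_subst [computable_intros]:
  assumes "computable a f" "computable a g"
  shows "computable a (\<lambda>b c. code (fm_subst (subst_of (f b c)) (decode (g b c))))"
proof (rule computable_comp2[OF _ assms])
  have "computable a (\<lambda>b c. code (fm_subst (subst_of (pfst c)) (decode (psnd c))))"
    by (rule computable_fm_rec[where \<Phi> = "\<lambda>b c \<phi>. code (fm_subst (subst_of (pfst c)) \<phi>)"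
        and v = "\<lambda>b p c. code (subst_of (pfst c) p)" and bt = "\<lambda>b c. prod_encode (1, 0)"
        and an = "\<lambda>b x y c. prod_encode (2, prod_encode (x, y))"
        and im = "\<lambda>b x y c. prod_encode (3, prod_encode (x, y))"
        and bx = "\<lambda>b x c. prod_encode (4, x)"])
       ((simp add: subst_of_def; fail) | (unfold subst_of_def)?, intro computable_intros)+
  then show "computable a (\<lambda>b c. code (fm_subst (subst_of (pfst c)) (decode (psnd c))))" .
qed

lemma decidable_box_free [computable_intros]:
  assumes "computable a f"
  shows "decidable a (\<lambda>b c. box_free (decode (f b c)))"
  by (rule computable_fm_rec[where \<Phi> = "\<lambda>b c \<phi>. of_bool (box_free \<phi>)"
      and v = "\<lambda>b p c. 1" and bt = "\<lambda>b c. 1" and an = "\<lambda>b x y c. x * y"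
      and im = "\<lambda>b x y c. x * y" and bx = "\<lambda>b x c. 0"])
     ((simp add: of_bool_conj; fail) | intro computable_intros assms)+

text \<open>The truth value of boxed formulas is an unknown constant, but every constant is recursive.\<close>

lemma decidable_truth_value [computable_intros]:
  assumes "computable a f" "computable a g"
  shows "decidable a (\<lambda>b c. truth_value (\<lambda>p. p \<in> set_decode (f b c)) (decode (g b c)))"
proof (rule computable_comp2[OF _ assms])
  show "decidable a (\<lambda>b c. truth_value (\<lambda>p. p \<in> set_decode (pfst c)) (decode (psnd c)))"
    by (rule computable_fm_rec[where
        \<Phi> = "\<lambda>b c \<phi>. of_bool (truth_value (\<lambda>p. p \<in> set_decode (pfst c)) \<phi>)"
        and v = "\<lambda>b p c. of_bool (p \<in> set_decode (pfst c))" and bt = "\<lambda>b c. 0"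
        and an = "\<lambda>b x y c. x * y" and im = "\<lambda>b x y c. of_bool (x = 1 \<longrightarrow> y = 1)"
        and bx = "\<lambda>b x c. of_bool undefined"])
       ((simp add: of_bool_conj; fail) | intro computable_intros)+
qed

text \<open>A frame code pairs the codes of its finite set of points and of a set of coded edges; edges
  between other points are discarded, so every code with nonempty first part yields a frame.\<close>

definition frame_of :: "nat \<Rightarrow> nat frame" where
  "frame_of f = (set_decode (pfst f),
     {(x, y). x \<in> set_decode (pfst f) \<and> y \<in> set_decode (pfst f) \<and>
        prod_encode (x, y) \<in> set_decode (psnd f)})"

lemma fst_frame_of: "fst (frame_of f) = set_decode (pfst f)"
  by (simp add: frame_of_def)

lemma edge_frame_of:
  "(x, y) \<in> snd (frame_of f) \<longleftrightarrow> x \<in> set_decode (pfst f) \<and> y \<in> set_decode (pfst f) \<and>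
     prod_encode (x, y) \<in> set_decode (psnd f)"
  by (simp add: frame_of_def)

definition val_of :: "nat \<Rightarrow> nat \<Rightarrow> nat \<Rightarrow> nat set" where
  "val_of f v p = {x \<in> set_decode (pfst f). prod_encode (p, x) \<in> set_decode v}"

definition refutes :: "nat \<Rightarrow> nat \<Rightarrow> fm \<Rightarrow> bool" where
  "refutes f v \<phi> \<longleftrightarrow> truth_set (frame_of f) (val_of f v) \<phi> \<noteq> fst (frame_of f)"

lemma truth_set_frame_of_subset: "truth_set (frame_of f) (val_of f v) \<phi> \<subseteq> set_decode (pfst f)"
  using truth_set_subset[of "val_of f v" "frame_of f" \<phi>] by (auto simp: val_of_def frame_of_def)

lemma finite_truth_set_frame_of: "finite (truth_set (frame_of f) (val_of f v) \<phi>)"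
  using truth_set_frame_of_subset finite_set_decode by (rule finite_subset)

text \<open>The whole truth set of a formula is computed at once, as a number; in this way the clause
  for \<^const>\<open>Box\<close> needs the value of its argument only, and not its values at other points.\<close>

lemma decidable_refutes [computable_intros]:
  assumes "computable a f" "computable a g" "computable a h"
  shows "decidable a (\<lambda>b c. refutes (f b c) (g b c) (decode (h b c)))"
proof (rule computable_comp3[OF _ assms])
  let ?f = "\<lambda>c. pfst c" and ?v = "\<lambda>c. pfst (psnd c)" and ?W = "\<lambda>c. pfst (pfst c)"
  let ?T = "\<lambda>c. truth_set (frame_of (?f c)) (val_of (?f c) (?v c))"
  let ?in = "\<lambda>x w. x \<in> set_decode w"
  have dec: "set_decode (set_encode (?T c \<phi>)) = ?T c \<phi>" for c \<phi>
    by (rule set_encode_inverse[OF finite_truth_set_frame_of])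
  have W: "x \<in> ?T c \<phi> \<Longrightarrow> x < ?W c \<and> ?in x (?W c)" for x c \<phi>
    using truth_set_frame_of_subset set_decode_less by blast
  have "computable a (\<lambda>b c. set_encode (?T c (decode (psnd (psnd c)))))"
  proof (rule computable_fm_rec[where \<Phi> = "\<lambda>b c \<phi>. set_encode (?T c \<phi>)"
      and v = "\<lambda>b p c. set_encode
         {x. x < ?W c \<and> ?in x (?W c) \<and> ?in (prod_encode (p, x)) (?v c)}"
      and bt = "\<lambda>b c. 0"
      and an = "\<lambda>b r s c. set_encode {x. x < ?W c \<and> ?in x r \<and> ?in x s}"
      and im = "\<lambda>b r s c. set_encode {x. x < ?W c \<and> ?in x (?W c) \<and> (?in x r \<longrightarrow> ?in x s)}"
      and bx = "\<lambda>b r c. set_encode {x. x < ?W c \<and> ?in x (?W c) \<and>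
         (\<forall>y < ?W c. ?in y (?W c) \<and> ?in (prod_encode (x, y)) (psnd (?f c)) \<longrightarrow> ?in y r)}"],
      goal_cases)
    case (2 b c p)
    show ?case
      by (auto simp: val_of_def dest: set_decode_less intro!: arg_cong[of _ _ set_encode])
  next
    case (6 b c \<phi> \<psi>)
    show ?case using W[of _ c \<phi>] unfolding dec truth_set.simps
      by (intro arg_cong[of _ _ set_encode]) blast
  next
    case (8 b c \<phi> \<psi>)
    show ?case using W[of _ c \<psi>] set_decode_less unfolding dec truth_set.simps fst_frame_of
      by (intro arg_cong[of _ _ set_encode]) blast
  next
    case (10 b c \<phi>)
    show ?case using set_decode_less unfolding dec truth_set.simps fst_frame_of edge_frame_of
      by (intro arg_cong[of _ _ set_encode]) blast
  qed ((simp; fail) | intro computable_intros)+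
  then have "decidable a (\<lambda>b c. \<not> set_encode (?T c (decode (psnd (psnd c)))) = ?W c)"
    by (intro computable_intros)
  moreover have "set_encode (?T c \<phi>) = ?W c \<longleftrightarrow> ?T c \<phi> = set_decode (?W c)" for c \<phi>
    using dec set_decode_inverse by metis
  ultimately show "decidable a (\<lambda>b c. refutes (?f c) (?v c) (decode (psnd (psnd c))))"
    by (simp add: refutes_def frame_of_def)
qed

section \<open>Finite codes suffice\<close>

fun vars :: "fm \<Rightarrow> nat set" where
  "vars (Var p) = {p}"
| "vars Bot = {}"
| "vars (And \<phi> \<psi>) = vars \<phi> \<union> vars \<psi>"
| "vars (Imp \<phi> \<psi>) = vars \<phi> \<union> vars \<psi>"
| "vars (Box \<phi>) = vars \<phi>"

lemma finite_vars: "finite (vars \<phi>)"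
  by (induction \<phi>) auto

lemma fm_subst_cong: "(\<And>p. p \<in> vars \<phi> \<Longrightarrow> s p = t p) \<Longrightarrow> fm_subst s \<phi> = fm_subst t \<phi>"
  by (induction \<phi>) auto

lemma truth_value_cong:
  "(\<And>p. p \<in> vars \<phi> \<Longrightarrow> s p = t p) \<Longrightarrow> truth_value s \<phi> = truth_value t \<phi>"
  by (induction \<phi>) auto

lemma truth_set_cong:
  "(\<And>p. p \<in> vars \<phi> \<Longrightarrow> V p = U p) \<Longrightarrow> truth_set F V \<phi> = truth_set F U \<phi>"
  by (induction \<phi>) auto

lemma ex_subst_of: "\<exists>s. fm_subst (subst_of s) \<phi> = fm_subst \<sigma> \<phi>"
proof -
  obtain m where m: "\<forall>p\<in>vars \<phi>. p < m"
    using finite_vars finite_nat_set_iff_bounded by blast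
  obtain s where "\<forall>p<m. entry s p = code (\<sigma> p)"
    using ex_entry[of m "\<lambda>p. code (\<sigma> p)"] by blast
  then have "fm_subst (subst_of s) \<phi> = fm_subst \<sigma> \<phi>"
    using m by (intro fm_subst_cong) (simp add: subst_of_def)
  then show ?thesis ..
qed

lemma ex_truth_value: "\<exists>v. truth_value (\<lambda>p. p \<in> set_decode v) \<phi> = truth_value u \<phi>"
proof
  show "truth_value (\<lambda>p. p \<in> set_decode (set_encode {p \<in> vars \<phi>. u p})) \<phi> = truth_value u \<phi>"
    by (rule truth_value_cong) (simp add: finite_vars)
qed

lemma FFr_eq: "FFr = {frame_of f | f. pfst f \<noteq> 0}"
proof (intro set_eqI iffI)
  fix F assume "F \<in> FFr"
  then obtain W R where F: "F = (W, R)" "W \<noteq> {}" "R \<subseteq> W \<times> W" "finite W"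
    by (cases F) (auto simp: FFr_def kripke_frame_def)
  then have R: "finite R" by (meson finite_SigmaI finite_subset)
  let ?f = "prod_encode (set_encode W, set_encode (prod_encode ` R))"
  have "prod_encode (x, y) \<in> prod_encode ` R \<longleftrightarrow> (x, y) \<in> R" for x y
    by (auto dest: inj_onD[OF inj_prod_encode])
  then have "F = frame_of ?f"
    using F R by (auto simp: frame_of_def)
  moreover have "pfst ?f \<noteq> 0"
    using F by (metis pfst_prod_encode set_decode_zero set_encode_inverse)
  ultimately show "F \<in> {frame_of f | f. pfst f \<noteq> 0}" by blast
next
  fix F assume "F \<in> {frame_of f | f. pfst f \<noteq> 0}"
  then obtain f where f: "F = frame_of f" "pfst f \<noteq> 0" by blast
  then have "set_decode (pfst f) \<noteq> {}"
    by (metis set_decode_inverse set_encode_empty)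
  then show "F \<in> FFr"
    by (auto simp: f FFr_def kripke_frame_def frame_of_def)
qed

text \<open>On a finite frame the restriction of a valuation to the variables of one formula is a finite
  set of pairs, hence has a code.\<close>

lemma valid_frame_of: "valid (frame_of f) \<phi> \<longleftrightarrow> (\<forall>v. \<not> refutes f v \<phi>)"
proof
  assume "valid (frame_of f) \<phi>"
  then show "\<forall>v. \<not> refutes f v \<phi>"
    by (auto simp: valid_def refutes_def val_of_def frame_of_def)
next
  assume *: "\<forall>v. \<not> refutes f v \<phi>"
  show "valid (frame_of f) \<phi>"
    unfolding valid_def
  proof (intro allI impI)
    fix V :: "nat \<Rightarrow> nat set" assume "\<forall>p. V p \<subseteq> fst (frame_of f)"
    then have V: "\<And>p. V p \<subseteq> set_decode (pfst f)" by (simp add: frame_of_def)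
    let ?A = "prod_encode ` (SIGMA p:vars \<phi>. V p)"
    have "finite (V p)" for p using V finite_set_decode by (rule finite_subset)
    then have "finite ?A" using finite_vars by blast
    then have "val_of f (set_encode ?A) p = V p" if "p \<in> vars \<phi>" for p
      using V that by (auto simp: val_of_def inj_image_mem_iff[OF inj_prod_encode])
    then have "truth_set (frame_of f) V \<phi> = truth_set (frame_of f) (val_of f (set_encode ?A)) \<phi>"
      by (intro truth_set_cong) simp
    then show "truth_set (frame_of f) V \<phi> = fst (frame_of f)"
      using * by (simp add: refutes_def)
  qed
qed

section \<open>Arithmetical complexity of the conditions defining the span\<close>

lemma Pi02_forall_exists:
  assumes "decidable a (\<lambda>b c. P b (pfst c) (psnd c))"
  shows "Pi02 a {b. \<forall>m. \<exists>k. P b m k}"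
proof -
  have "recursive_functional a 2 (\<lambda>b xs. of_bool (P b (xs ! 0) (xs ! 1)))"
  proof -
    have "recursive_functional a 2 (\<lambda>b xs. prod_encode (xs ! 0, xs ! 1))"
      by (intro rf_prod_encode proj) simp_all
    from computable_rf[OF assms this] show ?thesis by simp
  qed
  then show ?thesis
    unfolding Pi02_def recursive_predicate_def
    by (intro exI[of _ "\<lambda>m k b. P b m k"] conjI exI) auto
qed

lemma Pi02_forall:
  assumes "decidable a P"
  shows "Pi02 a {b. \<forall>m. P b m}"
  using Pi02_forall_exists[of a "\<lambda>b m k. P b m"]
    computable_comp[OF assms computable_pfst[OF computable_id]] by simp

lemma Pi02_Int:
  assumes "Pi02 a X" "Pi02 a Y"
  shows "Pi02 a (X \<inter> Y)"
proof -
  have *: "\<exists>P. decidable a (\<lambda>b c. P b (pfst c) (psnd c)) \<and> Z = {b. \<forall>m. \<exists>k. P b m k}"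
    if Z: "Pi02 a Z" for Z
  proof -
    obtain R where R: "recursive_predicate a R \<and> (\<forall>b. b \<in> Z \<longleftrightarrow> (\<forall>m. \<exists>k. R m k b))"
      using Z unfolding Pi02_def by (rule exE)
    then obtain f where
      f: "recursive_functional a 2 f" "\<And>m k b. f b [m, k] = of_bool (R m k b)"
      unfolding recursive_predicate_def by blast
    have "recursive_functional a 1 (\<lambda>b xs. f b [pfst (xs ! 0), psnd (xs ! 0)])"
      by (intro rf_comp2[OF f(1)] rf_pfst rf_psnd proj) simp_all
    then have "decidable a (\<lambda>b c. R (pfst c) (psnd c) b)"
      by (simp add: computable_def f)
    then show ?thesis using R by (intro exI[of _ "\<lambda>b m k. R m k b"]) auto
  qed
  obtain P Q where P: "decidable a (\<lambda>b c. P b (pfst c) (psnd c))" "X = {b. \<forall>m. \<exists>k. P b m k}"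
    and Q: "decidable a (\<lambda>b c. Q b (pfst c) (psnd c))" "Y = {b. \<forall>m. \<exists>k. Q b m k}"
    using *[OF assms(1)] *[OF assms(2)] by blast
  have "Pi02 a {b. \<forall>m. \<exists>k. P b m (pfst k) \<and> Q b m (psnd k)}"
    by (intro Pi02_forall_exists computable_comp2[OF P(1)] computable_comp2[OF Q(1)]
        computable_intros)
  moreover have "{b. \<forall>m. \<exists>k. P b m (pfst k) \<and> Q b m (psnd k)} = X \<inter> Y"
  proof (intro set_eqI iffI)
    fix b assume "b \<in> X \<inter> Y"
    have "\<exists>k. P b m (pfst k) \<and> Q b m (psnd k)" for m
    proof -
      obtain k l where "P b m k" "Q b m l" using \<open>b \<in> X \<inter> Y\<close> P(2) Q(2) by blast
      then show ?thesis by (intro exI[of _ "prod_encode (k, l)"]) simp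
    qed
    then show "b \<in> {b. \<forall>m. \<exists>k. P b m (pfst k) \<and> Q b m (psnd k)}" by blast
  qed (use P(2) Q(2) in blast)
  ultimately show ?thesis by simp
qed

lemma codes_iff: "code \<phi> \<in> codes L \<longleftrightarrow> \<phi> \<in> L"
  by (auto simp: codes_def dest: injD[OF inj_code])

lemma oplus_iff: "2 * n \<in> oplus A B \<longleftrightarrow> n \<in> A" "Suc (2 * n) \<in> oplus A B \<longleftrightarrow> n \<in> B"
  by (auto simp: oplus_def) presburger+

lemma all_decode: "(\<forall>n. P (decode n)) \<longleftrightarrow> (\<forall>\<phi>. P \<phi>)"
  by (metis decode_code)

lemma Pi02_code_sets: "Pi02 a {b. b \<subseteq> range code}"
proof -
  have "Pi02 a {b. \<forall>n. n \<in> b \<longrightarrow> code (decode n) = n}"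
    by (intro Pi02_forall computable_intros)
  moreover have "code (decode n) = n \<longleftrightarrow> n \<in> range code" for n
    by (metis decode_code rangeE rangeI)
  ultimately show ?thesis by (simp add: subset_iff)
qed

text \<open>Being a tautology is a universal condition on valuations; as a hypothesis it turns into an
  existential quantifier over valuations that may falsify the formula.\<close>

lemma Pi02_tautologies: "Pi02 a {b. \<forall>\<phi>. tautology \<phi> \<longrightarrow> code \<phi> \<in> b}"
proof -
  have "Pi02 a {b. \<forall>n. \<exists>v. box_free (decode n) \<and>
      truth_value (\<lambda>p. p \<in> set_decode v) (decode n) \<longrightarrow> code (decode n) \<in> b}"
    by (intro Pi02_forall_exists computable_intros)
  moreover have "tautology \<phi> \<longleftrightarrow>
      (\<forall>v. box_free \<phi> \<and> truth_value (\<lambda>p. p \<in> set_decode v) \<phi>)" for \<phi>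
    unfolding tautology_def using ex_truth_value[of \<phi>] by metis
  then have "(\<forall>n. \<exists>v. box_free (decode n) \<and>
      truth_value (\<lambda>p. p \<in> set_decode v) (decode n) \<longrightarrow> code (decode n) \<in> b) \<longleftrightarrow>
      (\<forall>\<phi>. tautology \<phi> \<longrightarrow> code \<phi> \<in> b)" for b
    by (metis decode_code)
  ultimately show ?thesis by simp
qed

lemma Pi02_modus_ponens:
  "Pi02 a {b. \<forall>\<phi> \<psi>. code \<phi> \<in> b \<and> code (Imp \<phi> \<psi>) \<in> b \<longrightarrow> code \<psi> \<in> b}"
proof -
  have "Pi02 a {b. \<forall>n. code (decode (pfst n)) \<in> b \<and>
      code (Imp (decode (pfst n)) (decode (psnd n))) \<in> b \<longrightarrow> code (decode (psnd n)) \<in> b}"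
    by (intro Pi02_forall computable_intros)
  moreover have "(\<forall>n. code (decode (pfst n)) \<in> b \<and>
      code (Imp (decode (pfst n)) (decode (psnd n))) \<in> b \<longrightarrow> code (decode (psnd n)) \<in> b) \<longleftrightarrow>
      (\<forall>\<phi> \<psi>. code \<phi> \<in> b \<and> code (Imp \<phi> \<psi>) \<in> b \<longrightarrow> code \<psi> \<in> b)" for b
    by (metis decode_code pfst_prod_encode psnd_prod_encode)
  ultimately show ?thesis by simp
qed

lemma Pi02_necessitation: "Pi02 a {b. \<forall>\<phi>. code \<phi> \<in> b \<longrightarrow> code (Box \<phi>) \<in> b}"
proof -
  have "Pi02 a {b. \<forall>n. code (decode n) \<in> b \<longrightarrow> code (Box (decode n)) \<in> b}"
    by (intro Pi02_forall computable_intros)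
  then show ?thesis
    by (simp only: all_decode[of "\<lambda>\<phi>. code \<phi> \<in> _ \<longrightarrow> code (Box \<phi>) \<in> _"])
qed

lemma Pi02_substitution: "Pi02 a {b. \<forall>\<phi> \<sigma>. code \<phi> \<in> b \<longrightarrow> code (fm_subst \<sigma> \<phi>) \<in> b}"
proof -
  have "Pi02 a {b. \<forall>n. code (decode (pfst n)) \<in> b \<longrightarrow>
      code (fm_subst (subst_of (psnd n)) (decode (pfst n))) \<in> b}"
    by (intro Pi02_forall computable_intros)
  moreover have "(\<forall>n. code (decode (pfst n)) \<in> b \<longrightarrow>
      code (fm_subst (subst_of (psnd n)) (decode (pfst n))) \<in> b) \<longleftrightarrow>
      (\<forall>\<phi> \<sigma>. code \<phi> \<in> b \<longrightarrow> code (fm_subst \<sigma> \<phi>) \<in> b)" for b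
    by (metis decode_code pfst_prod_encode psnd_prod_encode ex_subst_of)
  ultimately show ?thesis by simp
qed

text \<open>Inclusion between two classes of finite frames has the right form without any bounded search
  for valuations: if a valuation on a frame refutes a member of the second logic, then
  some valuation on the same frame refutes a member of the first one.\<close>

lemma FFr_of_subset_iff:
  "FFr_of L \<subseteq> FFr_of M \<longleftrightarrow>
     (\<forall>f v \<phi>. \<exists>u \<psi>. pfst f \<noteq> 0 \<and> \<phi> \<in> M \<and> refutes f v \<phi> \<longrightarrow> \<psi> \<in> L \<and> refutes f u \<psi>)"
proof -
  have "FFr_of L \<subseteq> FFr_of M \<longleftrightarrow>
      (\<forall>f. pfst f \<noteq> 0 \<longrightarrow> (\<forall>\<psi>\<in>L. valid (frame_of f) \<psi>) \<longrightarrow> (\<forall>\<phi>\<in>M. valid (frame_of f) \<phi>))"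
    by (auto simp: FFr_of_def FFr_eq)
  then show ?thesis unfolding valid_frame_of by blast
qed

text \<open>The hypotheses are stated for families of logics depending on the argument \<open>b\<close>, so that the
  lemma covers both inclusions, with \<open>L\<close> given by the parameter and the other logic by \<open>b\<close>.\<close>

lemma Pi02_FFr_of_subset:
  assumes P: "decidable a (\<lambda>b c. code (decode c) \<in> codes (P b))"
    and Q: "decidable a (\<lambda>b c. code (decode c) \<in> codes (Q b))"
  shows "Pi02 a {b. FFr_of (P b) \<subseteq> FFr_of (Q b)}"
proof -
  have P': "decidable a (\<lambda>b c. decode (g b c) \<in> P b)"
    and Q': "decidable a (\<lambda>b c. decode (g b c) \<in> Q b)" if "computable a g" for g
    using computable_comp[OF P that] computable_comp[OF Q that] by (simp_all add: codes_iff)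
  let ?X = "\<lambda>b f v \<phi> u \<psi>.
    pfst f \<noteq> 0 \<and> \<phi> \<in> Q b \<and> refutes f v \<phi> \<longrightarrow> \<psi> \<in> P b \<and> refutes f u \<psi>"
  have "Pi02 a {b. \<forall>m. \<exists>k.
      ?X b (pfst (pfst m)) (psnd (pfst m)) (decode (psnd m)) (pfst k) (decode (psnd k))}"
    by (intro Pi02_forall_exists P' Q' computable_intros)
  moreover have coded: "(\<forall>m. \<exists>k.
      Y (pfst (pfst m)) (psnd (pfst m)) (decode (psnd m)) (pfst k) (decode (psnd k))) \<longleftrightarrow>
      (\<forall>f v \<phi>. \<exists>u \<psi>. Y f v \<phi> u \<psi>)" for Y
  proof (intro iffI allI)
    fix f v \<phi>
    assume "\<forall>m. \<exists>k.
      Y (pfst (pfst m)) (psnd (pfst m)) (decode (psnd m)) (pfst k) (decode (psnd k))"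
    from spec[OF this, of "prod_encode (prod_encode (f, v), code \<phi>)"]
    show "\<exists>u \<psi>. Y f v \<phi> u \<psi>" by auto
  next
    fix m
    assume "\<forall>f v \<phi>. \<exists>u \<psi>. Y f v \<phi> u \<psi>"
    then obtain u \<psi> where "Y (pfst (pfst m)) (psnd (pfst m)) (decode (psnd m)) u \<psi>" by blast
    then show "\<exists>k. Y (pfst (pfst m)) (psnd (pfst m)) (decode (psnd m)) (pfst k) (decode (psnd k))"
      by (intro exI[of _ "prod_encode (u, code \<psi>)"]) simp
  qed
  ultimately show ?thesis
    unfolding FFr_of_subset_iff coded[of "?X _"] by (simp only:)
qed

lemma normal_logic_iff:
  "normal_logic M \<longleftrightarrow>
     (\<forall>\<phi>. tautology \<phi> \<longrightarrow> \<phi> \<in> M) \<and> axiom_K \<in> M \<and>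
     (\<forall>\<phi> \<psi>. \<phi> \<in> M \<and> Imp \<phi> \<psi> \<in> M \<longrightarrow> \<psi> \<in> M) \<and>
     (\<forall>\<phi>. \<phi> \<in> M \<longrightarrow> Box \<phi> \<in> M) \<and>
     (\<forall>\<phi> \<sigma>. \<phi> \<in> M \<longrightarrow> fm_subst \<sigma> \<phi> \<in> M)"
  unfolding normal_logic_def subset_iff mem_Collect_eq by (rule refl)

text \<open>A logic is determined by its code set, so membership in the span can be read off from the code
  set alone once junk numbers are excluded. Equality of the frame classes is split into two
  inclusions because each of them has a \<open>\<forall>\<exists>\<close> form on its own.\<close>

lemma codes_fmp_span:
  "codes ` fmp_span L0 L =
     {b. b \<subseteq> range code} \<inter>
     {b. \<forall>\<phi>. tautology \<phi> \<longrightarrow> code \<phi> \<in> b} \<inter>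
     {b. code axiom_K \<in> b} \<inter>
     {b. \<forall>\<phi> \<psi>. code \<phi> \<in> b \<and> code (Imp \<phi> \<psi>) \<in> b \<longrightarrow> code \<psi> \<in> b} \<inter>
     {b. \<forall>\<phi>. code \<phi> \<in> b \<longrightarrow> code (Box \<phi>) \<in> b} \<inter>
     {b. \<forall>\<phi> \<sigma>. code \<phi> \<in> b \<longrightarrow> code (fm_subst \<sigma> \<phi>) \<in> b} \<inter>
     {b. codes L0 \<subseteq> b} \<inter>
     {b. FFr_of (code -` b) \<subseteq> FFr_of L} \<inter>
     {b. FFr_of L \<subseteq> FFr_of (code -` b)}" (is "_ = ?X")
proof (intro set_eqI iffI)
  fix b assume "b \<in> codes ` fmp_span L0 L"
  then obtain M where b: "b = codes M" and M: "normal_logic M" "L0 \<subseteq> M" "FFr_of M = FFr_of L"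
    unfolding fmp_span_def NExt_def by blast
  have M_eq: "code -` codes M = M" by (auto simp: codes_iff)
  have "codes M \<subseteq> range code" "codes L0 \<subseteq> codes M"
    using M(2) by (auto simp: codes_def)
  moreover have "FFr_of M \<subseteq> FFr_of L" "FFr_of L \<subseteq> FFr_of M"
    using M(3) by simp_all
  ultimately show "b \<in> ?X"
    using M(1) unfolding b M_eq normal_logic_iff Int_iff mem_Collect_eq codes_iff by blast
next
  fix b assume b: "b \<in> ?X"
  then have "b = codes (code -` b)" by (auto simp: codes_def)
  moreover have "L0 \<subseteq> code -` b" using b by (auto simp: codes_def)
  then have "code -` b \<in> fmp_span L0 L"
    using b unfolding fmp_span_def NExt_def normal_logic_iff Int_iff mem_Collect_eq vimage_eq
    by blast
  ultimately show "b \<in> codes ` fmp_span L0 L" by blast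
qed

theorem lemma3p7:
  fixes L0 L :: "fm set"
  assumes "normal_logic L0" and "L \<in> NExt L0"
  shows "Pi02 (oplus (codes L0) (codes L)) (codes ` fmp_span L0 L)"
proof -
  let ?a = "oplus (codes L0) (codes L)"
  have "decidable ?a (\<lambda>b c. Suc (2 * code (decode c)) \<in> ?a)"
    by (intro computable_intros)
  then have L: "decidable ?a (\<lambda>b c. code (decode c) \<in> codes L)"
    by (simp add: oplus_iff)
  have "decidable ?a (\<lambda>b c. code (decode c) \<in> b)"
    by (intro computable_intros)
  then have b: "decidable ?a (\<lambda>b c. code (decode c) \<in> codes (code -` b))"
    by (simp add: codes_iff)
  have "Pi02 ?a {b. \<forall>n. 2 * n \<in> ?a \<longrightarrow> n \<in> b}"
    by (intro Pi02_forall computable_intros)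
  then have L0: "Pi02 ?a {b. codes L0 \<subseteq> b}"
    by (simp add: oplus_iff subset_iff)
  have K: "Pi02 ?a {b. code axiom_K \<in> b}"
    using Pi02_forall[of ?a "\<lambda>b m. code axiom_K \<in> b"] by (simp add: computable_intros)
  show ?thesis
    unfolding codes_fmp_span
    by (intro Pi02_Int Pi02_code_sets Pi02_tautologies K Pi02_modus_ponens Pi02_necessitation
        Pi02_substitution L0 Pi02_FFr_of_subset[OF b L] Pi02_FFr_of_subset[OF L b])
qed

end
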